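(* Let $R$ be a commutative Frobenius ring with unity and with a fixed non-trivial involutory ring automorphism $x\mapsto\overline{x}$. Let $k,n\in\mathbb{N}$, $x_1,x_2,x_3\in R$, and $\mathbf{a}_i=(a_{i:0},\dots,a_{i:n-1})\in R^n$ for $i\in\{0,\dots,k-1\}$, with $A_i=\mathrm{circ}(\mathbf{a}_i)$. Let $X_2\in R^{kn}$ be the row vector all of whose entries equal $x_2$, and $X_3\in R^{kn}$ the row vector all of whose entries equal $x_3$. Let $$G=\begin{pmatrix} I_{kn+1} & X\end{pmatrix},\quad X=\begin{pmatrix} x_1 & X_2\\ X_3^T & Y\end{pmatrix},\quad Y=\mathrm{circ}(A_0,A_1,\dots,A_{k-1}).$$ Then $G$ is a generator matrix of a Hermitian self-dual $[2(kn+1),kn+1]$-code over $R$ if and only if all of the following hold: (i) $1+x_1\overline{x_1}+knx_2\overline{x_2}=0$; (ii) $x_1\overline{x_3}+x_2\sum_{i=0}^{k-1}\sum_{s=0}^{n-1}\overline{a_{i:s}}=0$; (iii) $\sum_{i=0}^{k-1}\Theta(\mathbf{a}_i,\overline{\mathbf{a}_i},t)=-1-x_3\overline{x_3}$ for $t=0$ and $=-x_3\overline{x_3}$ for $t\in\{1,\dots,\lfloor n/2\rfloor\}$; (iv) $\sum_{i=0}^{k-1}\Theta(\mathbf{a}_{[i+j]_k},\overline{\mathbf{a}_i},0)=-x_3\overline{x_3}$ for every $j\in\{1,\dots,\lfloor k/2\rfloor\}$; (v) $\sum_{i=0}^{k-1}\Theta(\mathbf{a}_{[i+j]_k},\overline{\mathbf{a}_i},t)=-x_3\overline{x_3}$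 for every $j\in\{1,\dots,k-1\}$ and $t\in\{1,\dots,\lfloor n/2\rfloor\}$.
   Context: For a vector or matrix over $R$, the bar denotes entrywise application of the involution. $\mathrm{circ}(\mathbf{v})$ for $\mathbf{v}\in R^n$ is the $n\times n$ circulant matrix whose first row is $\mathbf{v}$ and each subsequent row is the previous row shifted cyclically one place to the right; $\mathrm{circ}(A_0,\dots,A_{k-1})$ is the $kn\times kn$ block circulant matrix whose first block row is $(A_0,\dots,A_{k-1})$ and each subsequent block row is the previous one shifted cyclically one block to the right. $[m]_N\in\{0,\dots,N-1\}$ is the residue of $m$ modulo $N$. For $\mathbf{x}=(x_0,\dots,x_{n-1}),\mathbf{y}=(y_0,\dots,y_{n-1})\in R^n$ and $j\in\{0,\dots,n-1\}$: $\Theta(\mathbf{x},\mathbf{y},j)=\sum_{i=0}^{n-1}x_{[i+j]_n}y_i$. The Hermitian inner product on $R^N$ is $\langle\mathbf{x},\mathbf{y}\rangle_H=\sum_i x_i\overline{y_i}$; a code (the $R$-submodule generated by the rows of $G$) is Hermitian self-dual if it equals its Hermitian dual $\{\mathbf{x}:\langle\mathbf{x},\mathbf{y}\rangle_H=0\ \forall\mathbf{y}\in\mathcal{C}\}$. *)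

theory Defs
  imports "HOL-Algebra.QuotRing" "Jordan_Normal_Form.VS_Connect"
begin

section \<open>Commutative Frobenius rings\<close>

definition artinian_ring :: "('a, 'b) ring_scheme \<Rightarrow> bool" where
  "artinian_ring R \<longleftrightarrow>
     (\<forall>I :: nat \<Rightarrow> 'a set. (\<forall>m. ideal (I m) R \<and> I (Suc m) \<subseteq> I m) \<longrightarrow>
        (\<exists>m. \<forall>l\<ge>m. I l = I m))"

definition jacobson_radical :: "('a, 'b) ring_scheme \<Rightarrow> 'a set" where
  "jacobson_radical R = \<Inter> {M. maximalideal M R}"

definition minimal_ideal :: "'a set \<Rightarrow> ('a, 'b) ring_scheme \<Rightarrow> bool" where
  "minimal_ideal I R \<longleftrightarrow> ideal I R \<and> I \<noteq> {\<zero>\<^bsub>R\<^esub>} \<and>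
     (\<forall>J. ideal J R \<and> J \<subseteq> I \<longrightarrow> J = {\<zero>\<^bsub>R\<^esub>} \<or> J = I)"

text \<open>The sum of all minimal ideals.\<close>
definition socle :: "('a, 'b) ring_scheme \<Rightarrow> 'a set" where
  "socle R = genideal R (\<Union> {I. minimal_ideal I R})"

text \<open>An ideal, respectively the quotient by an ideal, as a module over the ring.\<close>
definition ideal_module :: "('a, 'b) ring_scheme \<Rightarrow> 'a set \<Rightarrow> ('a, 'a) module" where
  "ideal_module R I =
     \<lparr>carrier = I, mult = mult R, one = \<one>\<^bsub>R\<^esub>, zero = \<zero>\<^bsub>R\<^esub>, add = add R,
      smult = mult R\<rparr>"

definition quotient_module :: "('a, 'b) ring_scheme \<Rightarrow> 'a set \<Rightarrow> ('a, 'a set) module" where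
  "quotient_module R J =
     \<lparr>carrier = carrier (R Quot J), mult = mult (R Quot J), one = \<one>\<^bsub>R Quot J\<^esub>,
      zero = \<zero>\<^bsub>R Quot J\<^esub>, add = add (R Quot J),
      smult = (\<lambda>r A. (J +>\<^bsub>R\<^esub> r) \<otimes>\<^bsub>R Quot J\<^esub> A)\<rparr>"

text \<open>A commutative Artinian ring with \<open>R / J(R) \<cong> Soc(R)\<close> as \<open>R\<close>-modules; in particular this covers
  the finite commutative Frobenius rings.\<close>
definition comm_frobenius_ring :: "('a, 'b) ring_scheme \<Rightarrow> bool" where
  "comm_frobenius_ring R \<longleftrightarrow> cring R \<and> artinian_ring R \<and>
     (\<exists>f \<in> LinearCombinations.module_hom R (quotient_module R (jacobson_radical R)) (ideal_module R (socle R)).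
        bij_betw f (carrier (quotient_module R (jacobson_radical R)))
                   (carrier (ideal_module R (socle R))))"

definition nontrivial_involution :: "('a :: comm_ring_1 \<Rightarrow> 'a) \<Rightarrow> bool" where
  "nontrivial_involution \<sigma> \<longleftrightarrow> comm_ring_hom \<sigma> \<and> (\<forall>x. \<sigma> (\<sigma> x) = x) \<and> \<sigma> \<noteq> id"


section \<open>Circulant matrices\<close>

text \<open>Entry \<open>(r, c)\<close> of a circulant matrix has index \<open>c - r\<close> modulo the length; adding the length
  first keeps the subtraction on naturals from truncating.\<close>
definition circ :: "'a vec \<Rightarrow> 'a mat" where
  "circ v = mat (dim_vec v) (dim_vec v)
     (\<lambda>(r, c). v $ ((c + dim_vec v - r) mod dim_vec v))"

text \<open>\<open>k\<close> is the number of blocks in a block row, \<open>n\<close> the size of each (square) block.\<close>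
definition block_circ :: "nat \<Rightarrow> nat \<Rightarrow> (nat \<Rightarrow> 'a mat) \<Rightarrow> 'a mat" where
  "block_circ k n A = mat (k * n) (k * n)
     (\<lambda>(r, c). A ((c div n + k - r div n) mod k) $$ (r mod n, c mod n))"

definition Theta :: "'a :: comm_ring_1 vec \<Rightarrow> 'a vec \<Rightarrow> nat \<Rightarrow> 'a" where
  "Theta x y j = (\<Sum>i<dim_vec x. x $ ((i + j) mod dim_vec x) * y $ i)"


section \<open>Linear codes\<close>

abbreviation code_span :: "nat \<Rightarrow> 'a :: comm_ring_1 vec set \<Rightarrow> 'a vec set" where
  "code_span N S \<equiv> LinearCombinations.module.span class_ring (module_vec TYPE('a) N) S"

text \<open>An \<open>[N, K]\<close>-code: a submodule of \<open>R\<^sup>N\<close> that is free of rank \<open>K\<close>.\<close>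
definition linear_code :: "nat \<Rightarrow> nat \<Rightarrow> 'a :: comm_ring_1 vec set \<Rightarrow> bool" where
  "linear_code N K C \<longleftrightarrow>
     submodule class_ring C (module_vec TYPE('a) N) \<and>
     (\<exists>B \<subseteq> carrier_vec N. finite B \<and> card B = K \<and>
        \<not> LinearCombinations.module.lin_dep class_ring (module_vec TYPE('a) N) B \<and>
        code_span N B = C)"

definition generator_matrix :: "'a :: comm_ring_1 mat \<Rightarrow> 'a vec set \<Rightarrow> bool" where
  "generator_matrix G C \<longleftrightarrow> C = code_span (dim_col G) (set (rows G))"

definition herm_prod :: "('a :: comm_ring_1 \<Rightarrow> 'a) \<Rightarrow> 'a vec \<Rightarrow> 'a vec \<Rightarrow> 'a" where
  "herm_prod \<sigma> x y = x \<bullet> map_vec \<sigma> y"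

definition herm_dual :: "('a :: comm_ring_1 \<Rightarrow> 'a) \<Rightarrow> nat \<Rightarrow> 'a vec set \<Rightarrow> 'a vec set" where
  "herm_dual \<sigma> N C = {x \<in> carrier_vec N. \<forall>y \<in> C. herm_prod \<sigma> x y = 0}"

definition herm_self_dual :: "('a :: comm_ring_1 \<Rightarrow> 'a) \<Rightarrow> nat \<Rightarrow> 'a vec set \<Rightarrow> bool" where
  "herm_self_dual \<sigma> N C \<longleftrightarrow> C = herm_dual \<sigma> N C"

text \<open>The block matrix \<open>(A B)\<close>, for \<open>A\<close> and \<open>B\<close> with equally many rows.\<close>
definition hconcat :: "'a :: zero mat \<Rightarrow> 'a mat \<Rightarrow> 'a mat" where
  "hconcat A B = four_block_mat A B (0\<^sub>m 0 (dim_col A)) (0\<^sub>m 0 (dim_col B))"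

end

theory Submission
  imports Defs
begin

text \<open>
  Since \<open>G = (I X)\<close> generates \<open>{(w, w X)}\<close> freely, and the Hermitian dual of that code consists of the
  \<open>(u, v)\<close> with \<open>u = - v X\<^sup>*\<close>, self-duality amounts to \<open>X X\<^sup>* = - I\<close>; the reverse direction uses that
  one-sided inverses of square matrices over a commutative ring are two-sided. The entries of
  \<open>X X\<^sup>*\<close> that involve the border give (i) and (ii). Those of \<open>Y Y\<^sup>*\<close> depend only on the
  block difference \<open>j\<close> and the inner difference \<open>t\<close> of the two rows, and swapping the rows negates
  both and applies the involution. Hence the values for \<open>t \<le> n / 2\<close>, and for \<open>j \<le> k / 2\<close> when
  \<open>t = 0\<close>, determine the remaining ones.
\<close>

section \<open>Systematic generator matrices\<close>

text \<open>Vectors are columns here, so the row vector \<open>w G\<close> appears as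
  \<open>G\<^sup>T *\<^sub>v w\<close>. The span is taken over a set while \<open>w\<close> has one
  coefficient per row; passing through \<open>lincomb_list\<close> takes care of repeated rows,
  whose coefficients \<open>mk_coeff\<close> adds up.\<close>

lemma (in vec_module) span_rows:
  assumes G: "G \<in> carrier_mat m n"
  shows "span (set (rows G)) = {G\<^sup>T *\<^sub>v w | w. w \<in> carrier_vec m}"
proof -
  have rows: "set (rows G) \<subseteq> carrier_vec n"
    using G by (auto simp: rows_def)
  have lin: "lincomb_list c (rows G) = G\<^sup>T *\<^sub>v vec m c" for c
  proof -
    have "mat_of_cols n (rows G) = G\<^sup>T"
      using mat_of_cols_cols[of "G\<^sup>T"] G by simp
    moreover have "\<forall>w \<in> set (rows G). dim_vec w = n"
      using rows carrier_vecD by blast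
    ultimately show ?thesis
      using lincomb_list_as_mat_mult[of "rows G" c] G by simp
  qed
  have span: "span (set (rows G)) = {lincomb f (set (rows G)) | f. True}"
    using finite_span[OF _ rows] by simp
  show ?thesis
  proof (intro equalityI subsetI)
    fix x assume "x \<in> span (set (rows G))"
    then obtain f where "x = lincomb f (set (rows G))"
      unfolding span by blast
    then show "x \<in> {G\<^sup>T *\<^sub>v w | w. w \<in> carrier_vec m}"
      unfolding lincomb_as_lincomb_list[OF rows] lin by auto
  next
    fix x assume "x \<in> {G\<^sup>T *\<^sub>v w | w. w \<in> carrier_vec m}"
    then obtain w where w: "w \<in> carrier_vec m" and x: "x = G\<^sup>T *\<^sub>v w"
      by blast
    have "vec m (\<lambda>i. w $ i) = w"
      using w by auto
    then have "x = lincomb_list (\<lambda>i. w $ i) (rows G)"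
      unfolding x lin by simp
    also have "\<dots> = lincomb (mk_coeff (rows G) (\<lambda>i. w $ i)) (set (rows G))"
      using lincomb_list_as_lincomb[OF rows] by simp
    finally show "x \<in> span (set (rows G))"
      unfolding span by blast
  qed
qed

lemma hconcat_carrier:
  "A \<in> carrier_mat m n1 \<Longrightarrow> B \<in> carrier_mat m n2 \<Longrightarrow> hconcat A B \<in> carrier_mat m (n1 + n2)"
  unfolding hconcat_def carrier_mat_def by auto

lemma transpose_hconcat_mult_vec:
  fixes A B :: "'a :: comm_ring_1 mat"
  assumes A: "A \<in> carrier_mat m n1" and B: "B \<in> carrier_mat m n2" and w: "w \<in> carrier_vec m"
  shows "(hconcat A B)\<^sup>T *\<^sub>v w = (A\<^sup>T *\<^sub>v w) @\<^sub>v (B\<^sup>T *\<^sub>v w)"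
proof (rule eq_vecI)
  fix i assume "i < dim_vec ((A\<^sup>T *\<^sub>v w) @\<^sub>v (B\<^sup>T *\<^sub>v w))"
  then have i: "i < n1 + n2"
    using A B by simp
  have "col (hconcat A B) i = (if i < n1 then col A i else col B (i - n1))"
    using A B i by (auto simp: hconcat_def col_def)
  then show "((hconcat A B)\<^sup>T *\<^sub>v w) $ i = ((A\<^sup>T *\<^sub>v w) @\<^sub>v (B\<^sup>T *\<^sub>v w)) $ i"
    using A B i hconcat_carrier[OF A B] by auto
qed (use hconcat_carrier[OF A B] A B in auto)

lemma append_vec_eq_zero:
  assumes "u @\<^sub>v v = 0\<^sub>v (m + l)" and "u \<in> carrier_vec m"
  shows "u = 0\<^sub>v m"
proof (rule eq_vecI)
  fix i assume "i < dim_vec (0\<^sub>v m)"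
  then have "i < dim_vec u"
    using assms by simp
  then have "(u @\<^sub>v v) $ i = u $ i" by simp
  then show "u $ i = 0\<^sub>v m $ i"
    using assms \<open>i < dim_vec u\<close> by simp
qed (use assms in auto)

lemma code_span_systematic:
  fixes X :: "'a :: comm_ring_1 mat"
  assumes X: "X \<in> carrier_mat m l"
  shows "code_span (m + l) (set (rows (hconcat (1\<^sub>m m) X))) =
    {w @\<^sub>v X\<^sup>T *\<^sub>v w | w. w \<in> carrier_vec m}"
proof -
  interpret vec_module "TYPE('a)" "m + l" .
  have eq: "(hconcat (1\<^sub>m m) X)\<^sup>T *\<^sub>v w = w @\<^sub>v X\<^sup>T *\<^sub>v w" if "w \<in> carrier_vec m" for w
    using transpose_hconcat_mult_vec[OF one_carrier_mat X that] that by simp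
  have "{(hconcat (1\<^sub>m m) X)\<^sup>T *\<^sub>v w | w. w \<in> carrier_vec m}
      = {w @\<^sub>v X\<^sup>T *\<^sub>v w | w. w \<in> carrier_vec m}"
    using eq by (intro Collect_cong) metis
  then show ?thesis
    using span_rows[OF hconcat_carrier[OF one_carrier_mat X]] by simp
qed

text \<open>The identity block makes the rows distinct, so they form a set of size \<open>m\<close>,
  and it displays the coefficients of any combination in the first \<open>m\<close> coordinates, so
  only the trivial combination vanishes.\<close>

lemma linear_code_systematic:
  fixes X :: "'a :: comm_ring_1 mat"
  assumes X: "X \<in> carrier_mat m l"
  shows "linear_code (m + l) m (code_span (m + l) (set (rows (hconcat (1\<^sub>m m) X))))"
proof -
  interpret vec_module "TYPE('a)" "m + l" .
  let ?G = "hconcat (1\<^sub>m m) X"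
  have G: "?G \<in> carrier_mat m (m + l)"
    by (rule hconcat_carrier[OF one_carrier_mat X])
  have rows: "set (rows ?G) \<subseteq> carrier_vec (m + l)"
    using G by (auto simp: rows_def)
  have entry: "?G $$ (i, j) = (if i = j then 1 else 0)" if "i < m" "j < m" for i j
    using that X by (auto simp: hconcat_def)
  have distinct: "distinct (rows ?G)"
  proof (unfold distinct_conv_nth, intro allI impI)
    fix i j assume "i < length (rows ?G)" "j < length (rows ?G)" "i \<noteq> j"
    then have ij: "i < m" "j < m" "i \<noteq> j"
      using G by auto
    then have "row ?G i $ i \<noteq> row ?G j $ i"
      using G entry by simp
    then have "row ?G i \<noteq> row ?G j"
      by metis
    then show "rows ?G ! i \<noteq> rows ?G ! j"
      using ij G by simp
  qed
  have indep: "\<not> lin_dep (set (rows ?G))"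
  proof
    assume "lin_dep (set (rows ?G))"
    then obtain f v where f: "lincomb f (set (rows ?G)) = 0\<^sub>v (m + l)"
        and v: "v \<in> set (rows ?G)" "f v \<noteq> 0"
      using finite_lin_dep[OF _ _ rows] by auto
    obtain i where i: "i < m" "v = rows ?G ! i"
      using v(1) G by (metis carrier_matD(1) in_set_conv_nth length_rows)
    \<comment> \<open>Coefficients are indexed by row position instead of by row; this loses nothing
      because the rows are distinct.\<close>
    let ?w = "vec m (\<lambda>i. f (rows ?G ! i))"
    have "mat_of_cols (m + l) (rows ?G) = ?G\<^sup>T"
      using mat_of_cols_cols[of "?G\<^sup>T"] G by simp
    moreover have "\<forall>v \<in> set (rows ?G). dim_vec v = m + l"
      using rows carrier_vecD by blast
    ultimately have "lincomb f (set (rows ?G)) = ?G\<^sup>T *\<^sub>v ?w"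
      using lincomb_as_lincomb_list_distinct[OF rows distinct] G
        lincomb_list_as_mat_mult[of "rows ?G" "\<lambda>i. f (rows ?G ! i)"] by simp
    then have "?w @\<^sub>v X\<^sup>T *\<^sub>v ?w = 0\<^sub>v (m + l)"
      using f transpose_hconcat_mult_vec[OF one_carrier_mat X, of ?w] by simp
    then have "?w = 0\<^sub>v m"
      by (rule append_vec_eq_zero) simp
    then have "?w $ i = 0"
      using i by simp
    then show False
      using i v by simp
  qed
  have "card (set (rows ?G)) = m"
    using distinct_card[OF distinct] G by simp
  moreover have "submodule class_ring (span (set (rows ?G))) V"
    using span_is_submodule[OF rows] .
  ultimately show ?thesis
    unfolding linear_code_def using rows indep by blast
qed

section \<open>Hermitian self-duality\<close>

text \<open>Determinants show that \<open>det B\<close> is inverse to \<open>det A\<close>, so the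
  adjugate of \<open>A\<close> scaled by \<open>det B\<close> is a left inverse \<open>?C\<close> of
  \<open>A\<close>. Then \<open>?C = ?C * (A * B) = (?C * A) * B = B\<close>.\<close>

lemma mat_left_right_inverse:
  fixes A B :: "'a :: comm_ring_1 mat"
  assumes A: "A \<in> carrier_mat n n" and B: "B \<in> carrier_mat n n" and AB: "A * B = 1\<^sub>m n"
  shows "B * A = 1\<^sub>m n"
proof -
  let ?C = "det B \<cdot>\<^sub>m adj_mat A"
  have C: "?C \<in> carrier_mat n n"
    using adj_mat(1)[OF A] by simp
  have "det B * det A = 1"
    using det_mult[OF A B] AB by (simp add: mult.commute)
  then have "det B \<cdot>\<^sub>m (det A \<cdot>\<^sub>m 1\<^sub>m n) = 1\<^sub>m n"
    by (intro eq_matI) auto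
  then have CA: "?C * A = 1\<^sub>m n"
    using adj_mat(3)[OF A] mult_smult_assoc_mat[OF adj_mat(1)[OF A] A] by simp
  have "?C = ?C * (A * B)"
    using AB right_mult_one_mat[OF C] by simp
  also have "\<dots> = B"
    using CA assoc_mult_mat[OF C A B] B by simp
  finally show ?thesis
    using CA by simp
qed

locale ring_involution = comm_ring_hom hom for hom :: "'a :: comm_ring_1 \<Rightarrow> 'a" +
  assumes hom_hom [simp]: "hom (hom x) = x"
begin

text \<open>Moving the transposed matrix across the scalar product leaves a pairing with the
  conjugated message alone, so orthogonality to all codewords becomes a single vector
  equation.\<close>

lemma herm_prod_systematic:
  assumes X: "X \<in> carrier_mat m m"
    and u: "u \<in> carrier_vec m" and v: "v \<in> carrier_vec m" and w: "w \<in> carrier_vec m"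
  shows "herm_prod hom (u @\<^sub>v v) (w @\<^sub>v X\<^sup>T *\<^sub>v w) = (u + mat\<^sub>h X *\<^sub>v v) \<bullet> vec\<^sub>h w"
proof -
  have hX: "mat\<^sub>h X \<in> carrier_mat m m" and hw: "vec\<^sub>h w \<in> carrier_vec m"
    using X w by auto
  have app: "vec\<^sub>h (w @\<^sub>v X\<^sup>T *\<^sub>v w) = vec\<^sub>h w @\<^sub>v (mat\<^sub>h X)\<^sup>T *\<^sub>v vec\<^sub>h w"
  proof -
    have "vec\<^sub>h (w @\<^sub>v X\<^sup>T *\<^sub>v w) = vec\<^sub>h w @\<^sub>v vec\<^sub>h (X\<^sup>T *\<^sub>v w)"
      using X w by (intro eq_vecI) auto
    also have "vec\<^sub>h (X\<^sup>T *\<^sub>v w) = mat\<^sub>h (X\<^sup>T) *\<^sub>v vec\<^sub>h w"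
      using X w by (intro mult_mat_vec_hom) auto
    also have "mat\<^sub>h (X\<^sup>T) = (mat\<^sub>h X)\<^sup>T"
      by (rule eq_matI) auto
    finally show ?thesis .
  qed
  have "v \<bullet> ((mat\<^sub>h X)\<^sup>T *\<^sub>v vec\<^sub>h w) = (mat\<^sub>h X *\<^sub>v v) \<bullet> vec\<^sub>h w"
    using transpose_vec_mult_scalar[OF hX v hw] hX hw v
      comm_scalar_prod[of "vec\<^sub>h w" m "mat\<^sub>h X *\<^sub>v v"]
      comm_scalar_prod[of "(mat\<^sub>h X)\<^sup>T *\<^sub>v vec\<^sub>h w" m v] by auto
  moreover have "(u @\<^sub>v v) \<bullet> (vec\<^sub>h w @\<^sub>v (mat\<^sub>h X)\<^sup>T *\<^sub>v vec\<^sub>h w)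
      = u \<bullet> vec\<^sub>h w + v \<bullet> ((mat\<^sub>h X)\<^sup>T *\<^sub>v vec\<^sub>h w)"
    using u v hX hw by (intro scalar_prod_append) auto
  ultimately show ?thesis
    unfolding herm_prod_def app
    using add_scalar_prod_distrib[OF u, of "mat\<^sub>h X *\<^sub>v v" "vec\<^sub>h w"] hX hw v by auto
qed

lemma herm_dual_systematic:
  assumes X: "X \<in> carrier_mat m m"
  shows "herm_dual hom (m + m) {w @\<^sub>v X\<^sup>T *\<^sub>v w | w. w \<in> carrier_vec m} =
    {u @\<^sub>v v | u v. u \<in> carrier_vec m \<and> v \<in> carrier_vec m \<and> u + mat\<^sub>h X *\<^sub>v v = 0\<^sub>v m}"
    (is "?L = ?R")
proof (intro equalityI subsetI)
  fix x assume x: "x \<in> ?L"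
  then have "x \<in> carrier_vec (m + m)"
    by (simp add: herm_dual_def)
  then obtain u v where uv: "u \<in> carrier_vec m" "v \<in> carrier_vec m" "x = u @\<^sub>v v"
    by (metis vec_first_carrier vec_last_carrier vec_first_last_append)
  let ?z = "u + mat\<^sub>h X *\<^sub>v v"
  have z: "?z \<in> carrier_vec m"
    using uv X by auto
  have "?z = 0\<^sub>v m"
  proof (rule eq_vecI)
    fix i assume i: "i < dim_vec (0\<^sub>v m)"
    \<comment> \<open>Unit vectors are fixed by conjugation, so pairing with their codewords reads
      off the coordinates of \<open>?z\<close>.\<close>
    have "vec\<^sub>h (unit_vec m i) = unit_vec m i"
      using i by (intro eq_vecI) (auto simp: unit_vec_def)
    moreover have "herm_prod hom x (unit_vec m i @\<^sub>v X\<^sup>T *\<^sub>v unit_vec m i) = 0"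
      using x unit_vec_carrier[of m i] unfolding herm_dual_def by blast
    ultimately have "?z \<bullet> unit_vec m i = 0"
      using herm_prod_systematic[OF X uv(1,2) unit_vec_carrier[of m i]] uv(3) by simp
    then show "?z $ i = 0\<^sub>v m $ i"
      using i z by (simp add: scalar_prod_right_unit)
  qed (use carrier_vecD[OF z] in simp)
  then show "x \<in> ?R"
    using uv by blast
next
  fix x assume "x \<in> ?R"
  then obtain u v where uv: "u \<in> carrier_vec m" "v \<in> carrier_vec m" "x = u @\<^sub>v v"
      and z: "u + mat\<^sub>h X *\<^sub>v v = 0\<^sub>v m"
    by blast
  have "herm_prod hom x (w @\<^sub>v X\<^sup>T *\<^sub>v w) = 0" if "w \<in> carrier_vec m" for w
    using herm_prod_systematic[OF X uv(1,2) that] uv(3) z that by simp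
  then show "x \<in> ?L"
    using uv by (auto simp: herm_dual_def)
qed

text \<open>The matrix \<open>mat\<^sub>h X * X\<^sup>T\<close> is the entrywise conjugate of X X^*.
  Since \<open>hom\<close> fixes 0 and -1, either of the two is minus the identity exactly when the
  other is.\<close>

lemma herm_self_dual_systematic:
  assumes X: "X \<in> carrier_mat m m"
  shows "herm_self_dual hom (m + m) {w @\<^sub>v X\<^sup>T *\<^sub>v w | w. w \<in> carrier_vec m} \<longleftrightarrow>
    mat\<^sub>h X * X\<^sup>T = - 1\<^sub>m m"
    (is "herm_self_dual hom _ ?C \<longleftrightarrow> ?gram")
proof -
  have hX: "mat\<^sub>h X \<in> carrier_mat m m" and tX: "X\<^sup>T \<in> carrier_mat m m"
    using X by auto
  show ?thesis
  proof
    assume sd: "herm_self_dual hom (m + m) ?C"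
    show ?gram
    proof (rule eq_matI)
      fix i j assume "i < dim_row (- 1\<^sub>m m :: 'a mat)" "j < dim_col (- 1\<^sub>m m :: 'a mat)"
      then have ij: "i < m" "j < m" by auto
      \<comment> \<open>The inclusion of the code in its dual suffices for this direction: the
        codeword of the \<open>j\<close>-th unit vector yields column \<open>j\<close> of the matrix
        equation.\<close>
      have e: "(unit_vec m j :: 'a vec) \<in> carrier_vec m" by simp
      then have "unit_vec m j @\<^sub>v X\<^sup>T *\<^sub>v unit_vec m j \<in> herm_dual hom (m + m) ?C"
        using sd unfolding herm_self_dual_def by blast
      then obtain u v where uv: "unit_vec m j @\<^sub>v X\<^sup>T *\<^sub>v unit_vec m j = u @\<^sub>v v"
          and u: "u \<in> carrier_vec m" and z: "u + mat\<^sub>h X *\<^sub>v v = 0\<^sub>v m"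
        unfolding herm_dual_systematic[OF X] by blast
      have "u = unit_vec m j" "v = X\<^sup>T *\<^sub>v unit_vec m j"
        using append_vec_eq[OF e u] uv by auto
      then have "unit_vec m j + (mat\<^sub>h X * X\<^sup>T) *\<^sub>v unit_vec m j = 0\<^sub>v m"
        using z assoc_mult_mat_vec[OF hX tX e] by simp
      then have "(unit_vec m j + (mat\<^sub>h X * X\<^sup>T) *\<^sub>v unit_vec m j) $ i = 0"
        using ij by simp
      moreover have "(P *\<^sub>v unit_vec m j) $ i = P $$ (i, j)" if "P \<in> carrier_mat m m" for P :: "'a mat"
        using ij that by (simp add: scalar_prod_right_unit)
      ultimately have "(if i = j then 1 else 0) + (mat\<^sub>h X * X\<^sup>T) $$ (i, j) = 0"
        using ij mult_carrier_mat[OF hX tX] by (simp del: index_mult_mat)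
      then show "(mat\<^sub>h X * X\<^sup>T) $$ (i, j) = (- 1\<^sub>m m) $$ (i, j)"
        using ij by (auto simp: add_eq_0_iff split: if_splits)
    qed (use X in auto)
  next
    assume gram: ?gram
    have "(- mat\<^sub>h X) * X\<^sup>T = 1\<^sub>m m"
      using gram hX tX by (auto simp: uminus_mult_left_mat)
    \<comment> \<open>The dual is cut out by \<open>u = - (mat\<^sub>h X *\<^sub>v v)\<close>;
      solving this for \<open>v\<close> requires the two factors in the opposite order.\<close>
    then have inv: "X\<^sup>T * (- mat\<^sub>h X) = 1\<^sub>m m"
      using mat_left_right_inverse[of "- mat\<^sub>h X" m "X\<^sup>T"] hX tX by simp
    have "u + mat\<^sub>h X *\<^sub>v v = 0\<^sub>v m \<longleftrightarrow> v = X\<^sup>T *\<^sub>v u"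
      if u: "u \<in> carrier_vec m" and v: "v \<in> carrier_vec m" for u v
    proof
      assume "u + mat\<^sub>h X *\<^sub>v v = 0\<^sub>v m"
      then have "u = - (mat\<^sub>h X *\<^sub>v v)"
        using u hX v by (auto simp: vec_eq_iff eq_neg_iff_add_eq_0)
      then have "u = (- mat\<^sub>h X) *\<^sub>v v"
        using hX v by simp
      then have "X\<^sup>T *\<^sub>v u = (X\<^sup>T * (- mat\<^sub>h X)) *\<^sub>v v"
        using assoc_mult_mat_vec[OF tX uminus_carrier_mat[OF hX] v] by simp
      then show "v = X\<^sup>T *\<^sub>v u"
        using inv v by simp
    next
      assume "v = X\<^sup>T *\<^sub>v u"
      then have "mat\<^sub>h X *\<^sub>v v = (- 1\<^sub>m m) *\<^sub>v u"
        using assoc_mult_mat_vec[OF hX tX u] gram by simp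
      also have "\<dots> = - u"
        using u by simp
      finally show "u + mat\<^sub>h X *\<^sub>v v = 0\<^sub>v m"
        using u by auto
    qed
    then have "herm_dual hom (m + m) ?C = {u @\<^sub>v v | u v. u \<in> carrier_vec m \<and> v = X\<^sup>T *\<^sub>v u}"
      unfolding herm_dual_systematic[OF X] using tX by (intro Collect_cong) (metis mult_mat_vec_carrier)
    then show "herm_self_dual hom (m + m) ?C"
      unfolding herm_self_dual_def by blast
  qed
qed

end

section \<open>Gram matrices of block circulants\<close>

lemma sum_rotate:
  fixes f :: "nat \<Rightarrow> 'b :: comm_monoid_add"
  shows "(\<Sum>i<n. f ((i + p) mod n)) = (\<Sum>i<n. f i)"
\<comment> \<open>Rotation by \<open>n - p mod n\<close> undoes rotation by \<open>p\<close>;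
  reducing \<open>p\<close> first keeps the natural subtraction from truncating.\<close>
proof (rule sum.reindex_bij_witness[where i = "\<lambda>i. (i + (n - p mod n)) mod n" and j = "\<lambda>i. (i + p) mod n"])
  fix i assume "i \<in> {..<n}"
  then have i: "i < n" by simp
  then have p: "p mod n \<le> n"
    by (simp add: order_less_imp_le)
  have *: "(i + p mod n + q) mod n = (i + p + q) mod n" for q
    by (metis mod_add_left_eq mod_add_right_eq)
  have "((i + p) mod n + (n - p mod n)) mod n = (i + p mod n + (n - p mod n)) mod n"
    unfolding * by (rule mod_add_left_eq)
  then show "((i + p) mod n + (n - p mod n)) mod n = i"
    using i p by simp
  have "((i + (n - p mod n)) mod n + p) mod n = (i + p mod n + (n - p mod n)) mod n"
    unfolding * by (subst mod_add_left_eq) (simp add: ac_simps)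
  then show "((i + (n - p mod n)) mod n + p) mod n = i"
    using i p by simp
qed auto

text \<open>Division with remainder identifies a column index with a block and a position inside
  it.\<close>

lemma sum_div_mod:
  fixes f :: "nat \<Rightarrow> nat \<Rightarrow> 'b :: comm_monoid_add"
  shows "(\<Sum>c<k * n. f (c div n) (c mod n)) = (\<Sum>i<k. \<Sum>s<n. f i s)"
proof -
  have "(\<Sum>i<k. \<Sum>s<n. f i s) = (\<Sum>(i, s)\<in>{..<k} \<times> {..<n}. f i s)"
    by (rule sum.cartesian_product)
  also have "\<dots> = (\<Sum>c<k * n. f (c div n) (c mod n))"
  proof (rule sum.reindex_bij_witness[where j = "\<lambda>(i, s). i * n + s" and i = "\<lambda>c. (c div n, c mod n)"])
    fix x assume x: "x \<in> {..<k} \<times> {..<n}"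
    then have "fst x * n + snd x < Suc (fst x) * n"
      by auto
    also have "\<dots> \<le> k * n"
      using x by (intro mult_le_mono) auto
    finally show "(case x of (i, s) \<Rightarrow> i * n + s) \<in> {..<k * n}"
      by (simp add: case_prod_beta)
  next
    fix c assume c: "c \<in> {..<k * n}"
    then have "n > 0"
      by (cases n) auto
    then show "(c div n, c mod n) \<in> {..<k} \<times> {..<n}"
      using c by (auto simp: less_mult_imp_div_less)
  qed auto
  finally show ?thesis by simp
qed

text \<open>Going forward by \<open>p\<close> and back by \<open>q\<close> is one rotation by the
  difference; this is the simplification needed after reindexing a sum with displaced
  indices.\<close>

lemma add_mod_sub_mod:
  fixes i p q n :: nat
  assumes "q < n"
  shows "((i + p) mod n + n - q) mod n = (i + (p + n - q) mod n) mod n"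
proof -
  have "((i + p) mod n + n - q) mod n = ((i + p) mod n + (n - q)) mod n"
    using assms by simp
  also have "\<dots> = (i + (p + (n - q))) mod n"
    by (simp add: mod_simps add.assoc)
  finally show ?thesis
    using assms by (simp add: mod_simps)
qed

lemma block_circ_index:
  assumes r: "r < k * n" and c: "c < k * n"
    and a: "\<And>i. i < k \<Longrightarrow> a i \<in> carrier_vec n" and A: "\<And>i. i < k \<Longrightarrow> A i = circ (a i)"
  shows "block_circ k n A $$ (r, c) =
    a ((c div n + k - r div n) mod k) $ ((c mod n + n - r mod n) mod n)"
proof -
  have "0 < k * n"
    using r by linarith
  then have k: "k > 0" and n: "n > 0" by auto
  let ?i = "(c div n + k - r div n) mod k"
  have i: "?i < k"
    using k by simp
  have "dim_vec (a ?i) = n"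
    using a[OF i] by simp
  then show ?thesis
    using r c n unfolding block_circ_def by (simp add: A[OF i] circ_def)
qed

section \<open>Correlation sums of a block circulant\<close>

context ring_involution
begin

text \<open>This is the Hermitian periodic autocorrelation of the \<open>k\<close> by
  \<open>n\<close> array \<open>a\<close> at the shift (j, t) in Z/k x Z/n.\<close>

definition block_theta :: "nat \<Rightarrow> nat \<Rightarrow> (nat \<Rightarrow> 'a vec) \<Rightarrow> nat \<Rightarrow> nat \<Rightarrow> 'a" where
  "block_theta k n a j t = (\<Sum>i<k. \<Sum>c<n. a ((i + j) mod k) $ ((c + t) mod n) * hom (a i $ c))"

lemma sum_Theta_eq_block_theta:
  assumes a: "\<And>i. i < k \<Longrightarrow> a i \<in> carrier_vec n"
  shows "(\<Sum>i<k. Theta (a ((i + j) mod k)) (vec\<^sub>h (a i)) t) = block_theta k n a j t"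
  unfolding block_theta_def
proof (rule sum.cong[OF refl])
  fix i assume "i \<in> {..<k}"
  then have "i < k" "(i + j) mod k < k" by auto
  then show "Theta (a ((i + j) mod k)) (vec\<^sub>h (a i)) t =
      (\<Sum>c<n. a ((i + j) mod k) $ ((c + t) mod n) * hom (a i $ c))"
    using carrier_vecD[OF a] unfolding Theta_def by simp
qed

text \<open>Rotating the block index by \<open>p'\<close> and the position by \<open>q'\<close>
  removes the displacement of the conjugated factor; the other factor keeps the difference.\<close>

lemma block_theta_shift:
  assumes "p < k" "p' < k" "q < n" "q' < n"
  shows "(\<Sum>i<k. \<Sum>c<n. a ((i + k - p) mod k) $ ((c + n - q) mod n) *
            hom (a ((i + k - p') mod k) $ ((c + n - q') mod n)))
       = block_theta k n a ((p' + k - p) mod k) ((q' + n - q) mod n)" (is "?L = _")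
proof -
  have "?L = (\<Sum>i<k. \<Sum>c<n. a (((i + p') mod k + k - p) mod k) $ ((c + n - q) mod n) *
            hom (a (((i + p') mod k + k - p') mod k) $ ((c + n - q') mod n)))"
    by (rule sum_rotate[symmetric])
  also have "\<dots> = (\<Sum>i<k. \<Sum>c<n. a (((i + p') mod k + k - p) mod k) $ (((c + q') mod n + n - q) mod n) *
            hom (a (((i + p') mod k + k - p') mod k) $ (((c + q') mod n + n - q') mod n)))"
    by (intro sum.cong refl sum_rotate[symmetric])
  also have "\<dots> = block_theta k n a ((p' + k - p) mod k) ((q' + n - q) mod n)"
    unfolding block_theta_def using assms by (intro sum.cong refl) (simp add: add_mod_sub_mod)
  finally show ?thesis .
qed

text \<open>Row \<open>r\<close> is the array displaced by \<open>(r div n, r mod n)\<close>, so the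
  product of two rows is an autocorrelation at the difference of their displacements.\<close>

lemma block_circ_gram:
  assumes r: "r < k * n" and s: "s < k * n"
    and a: "\<And>i. i < k \<Longrightarrow> a i \<in> carrier_vec n" and A: "\<And>i. i < k \<Longrightarrow> A i = circ (a i)"
  shows "(\<Sum>c<k * n. block_circ k n A $$ (r, c) * hom (block_circ k n A $$ (s, c))) =
    block_theta k n a ((s div n + k - r div n) mod k) ((s mod n + n - r mod n) mod n)"
proof -
  have "0 < k * n"
    using r by linarith
  then have n: "n > 0" by simp
  have "(\<Sum>c<k * n. block_circ k n A $$ (r, c) * hom (block_circ k n A $$ (s, c))) =
     (\<Sum>c<k * n. a ((c div n + k - r div n) mod k) $ ((c mod n + n - r mod n) mod n) *
            hom (a ((c div n + k - s div n) mod k) $ ((c mod n + n - s mod n) mod n)))"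
    using r s by (intro sum.cong refl) (simp add: block_circ_index[OF _ _ a A])
  also have "\<dots> = (\<Sum>i<k. \<Sum>c<n. a ((i + k - r div n) mod k) $ ((c + n - r mod n) mod n) *
            hom (a ((i + k - s div n) mod k) $ ((c + n - s mod n) mod n)))"
    by (rule sum_div_mod)
  also have "\<dots> = block_theta k n a ((s div n + k - r div n) mod k) ((s mod n + n - r mod n) mod n)"
    using r s n by (intro block_theta_shift) (auto simp: less_mult_imp_div_less)
  finally show ?thesis .
qed

text \<open>Each row lists all entries of the array in a cyclically rearranged order, which makes
  condition (ii) the same for every row.\<close>

lemma block_circ_row_sum:
  assumes r: "r < k * n"
    and a: "\<And>i. i < k \<Longrightarrow> a i \<in> carrier_vec n" and A: "\<And>i. i < k \<Longrightarrow> A i = circ (a i)"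
  shows "(\<Sum>c<k * n. hom (block_circ k n A $$ (r, c))) = (\<Sum>i<k. \<Sum>c<n. hom (a i $ c))"
proof -
  have "0 < k * n"
    using r by linarith
  then have "n > 0" by simp
  then have less: "r div n < k" "r mod n < n"
    using r by (auto simp: less_mult_imp_div_less)
  then have sub: "(i + k - r div n) mod k = (i + (k - r div n)) mod k"
      "(c + n - r mod n) mod n = (c + (n - r mod n)) mod n" for i c
    by simp_all
  have "(\<Sum>c<k * n. hom (block_circ k n A $$ (r, c))) =
     (\<Sum>c<k * n. hom (a ((c div n + k - r div n) mod k) $ ((c mod n + n - r mod n) mod n)))"
    using r by (intro sum.cong refl) (simp add: block_circ_index[OF _ _ a A])
  also have "\<dots> = (\<Sum>i<k. \<Sum>c<n. hom (a ((i + k - r div n) mod k) $ ((c + n - r mod n) mod n)))"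
    by (rule sum_div_mod)
  also have "\<dots> = (\<Sum>i<k. \<Sum>c<n. hom (a ((i + k - r div n) mod k) $ c))"
    unfolding sub by (intro sum.cong refl sum_rotate)
  also have "\<dots> = (\<Sum>i<k. \<Sum>c<n. hom (a i $ c))"
    unfolding sub by (rule sum_rotate)
  finally show ?thesis .
qed

text \<open>The involution interchanges the two factors of each summand. The shift then sits on the
  conjugated factor, where it counts as a displacement by (-j, -t).\<close>

lemma hom_block_theta:
  assumes "j < k" "t < n"
  shows "hom (block_theta k n a j t) = block_theta k n a ((k - j) mod k) ((n - t) mod n)"
proof -
  \<comment> \<open>The terms \<open>- 0\<close> give the sum the shape of
    \<open>block_theta_shift\<close> with zero displacement on the first factor.\<close>
  have "hom (block_theta k n a j t) =
      (\<Sum>i<k. \<Sum>c<n. a ((i + k - 0) mod k) $ ((c + n - 0) mod n) * hom (a ((i + j) mod k) $ ((c + t) mod n)))"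
    unfolding block_theta_def hom_sum hom_mult hom_hom
    by (intro sum.cong refl) (simp add: mult.commute)
  \<comment> \<open>A step forward by \<open>j\<close> is a step back by \<open>k - j\<close>. The
    outer \<open>mod k\<close> matters at \<open>j = 0\<close>, where the displacement must be
    \<open>0\<close> and not \<open>k\<close>; likewise for \<open>t\<close>.\<close>
  also have "\<dots> = (\<Sum>i<k. \<Sum>c<n. a ((i + k - 0) mod k) $ ((c + n - 0) mod n) *
      hom (a ((i + k - (k - j) mod k) mod k) $ ((c + n - (n - t) mod n) mod n)))"
    using assms by (intro sum.cong refl) (cases "j = 0"; cases "t = 0"; simp)
  also have "\<dots> = block_theta k n a (((k - j) mod k + k - 0) mod k) (((n - t) mod n + n - 0) mod n)"
    using assms by (intro block_theta_shift) auto
  finally show ?thesis by simp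
qed

text \<open>Since \<open>hom x = x\<close>, the prescribed values are fixed by \<open>hom\<close>,
  so a value at (j, t) follows from the one at (-j, -t). For nonzero \<open>t\<close> this
  reflection halves the range of \<open>t\<close>, so every \<open>j\<close> has to be listed; for
  \<open>t = 0\<close> it halves the range of \<open>j\<close>.\<close>

lemma block_theta_values_iff:
  assumes k: "k \<ge> 1" and n: "n \<ge> 1" and x: "hom x = x"
  shows "(\<forall>j<k. \<forall>t<n. block_theta k n a j t = (if j = 0 \<and> t = 0 then - 1 else 0) - x) \<longleftrightarrow>
    (block_theta k n a 0 0 = - 1 - x \<and> (\<forall>t\<in>{1..n div 2}. block_theta k n a 0 t = - x)) \<and>
    (\<forall>j\<in>{1..k div 2}. block_theta k n a j 0 = - x) \<and>
    (\<forall>j\<in>{1..k - 1}. \<forall>t\<in>{1..n div 2}. block_theta k n a j t = - x)"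
    (is "?all \<longleftrightarrow> ?half")
proof
  assume all: ?all
  have t: "t < n \<and> t \<noteq> 0" if "t \<in> {1..n div 2}" for t
    using that n by auto
  have j: "j < k \<and> j \<noteq> 0" if "j \<in> {1..k div 2} \<or> j \<in> {1..k - 1}" for j
    using that k by auto
  have "0 < k" "0 < n"
    using k n by auto
  then have "block_theta k n a 0 0 = - 1 - x"
    using all by simp
  moreover have "\<forall>t\<in>{1..n div 2}. block_theta k n a 0 t = - x"
    using all \<open>0 < k\<close> t by simp
  moreover have "\<forall>j\<in>{1..k div 2}. block_theta k n a j 0 = - x"
    using all \<open>0 < n\<close> j by simp
  moreover have "\<forall>j\<in>{1..k - 1}. \<forall>t\<in>{1..n div 2}. block_theta k n a j t = - x"
  proof (intro ballI)
    fix j' t' assume "j' \<in> {1..k - 1}" "t' \<in> {1..n div 2}"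
    then have "j' < k" "j' \<noteq> 0" "t' < n"
      using j t by blast+
    then show "block_theta k n a j' t' = - x"
      using all by simp
  qed
  ultimately show ?half by blast
next
  assume half: ?half
  have refl_t: "block_theta k n a j t = - x"
    if "block_theta k n a ((k - j) mod k) ((n - t) mod n) = - x" "j < k" "t < n" for j t
    using that(1) hom_block_theta[OF that(2,3), of a] x
    by (metis hom_hom hom_uminus)
  \<comment> \<open>If \<open>s\<close> lies beyond \<open>m div 2\<close>, its reflection
    \<open>m - s\<close> is at most \<open>m div 2\<close>, for even and odd \<open>m\<close>
    alike.\<close>
  have fold: "(m - s) mod m \<in> {1..m div 2}" if "s < m" "s \<noteq> 0" "s \<notin> {1..m div 2}" for s m :: nat
  proof -
    have "(m - s) mod m = m - s"
      using that by simp
    moreover have "1 \<le> m - s \<and> m - s \<le> m div 2"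
      using that unfolding atLeastAtMost_iff by presburger
    ultimately show ?thesis by simp
  qed
  have neg: "(m - s) mod m \<in> {1..m - 1}" if "s < m" "s \<noteq> 0" for s m :: nat
    using that by auto
  have t0: "block_theta k n a j t = - x" if j: "j < k" and t: "t < n" "t \<noteq> 0" for j t
  proof (cases "t \<in> {1..n div 2}")
    case True
    show ?thesis
    proof (cases "j = 0")
      case False
      then have "j \<in> {1..k - 1}"
        using j by simp
      then show ?thesis
        using True half by blast
    qed (use True half in blast)
  next
    case False
    then have t': "(n - t) mod n \<in> {1..n div 2}"
      using fold t by blast
    have "block_theta k n a ((k - j) mod k) ((n - t) mod n) = - x"
    \<comment> \<open>The block shift \<open>0\<close> is its own reflection, so its value comes
      from condition (iii); the reflection of any other block shift is covered by (v).\<close>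
    proof (cases "j = 0")
      case True
      then have "(k - j) mod k = 0" by simp
      then show ?thesis
        using t' half by metis
    next
      case False
      then show ?thesis
        using neg[OF j] t' half by blast
    qed
    then show ?thesis
      using refl_t j t by blast
  qed
  have j0: "block_theta k n a j 0 = - x" if j: "j < k" "j \<noteq> 0" for j
  proof (cases "j \<in> {1..k div 2}")
    case False
    \<comment> \<open>The inner shift \<open>0\<close> reflects to itself, so this is a value from
      condition (iv).\<close>
    then have "block_theta k n a ((k - j) mod k) ((n - 0) mod n) = - x"
      using fold[OF j] half by simp
    then show ?thesis
      using refl_t[of j 0] j n by simp
  qed (use half in blast)
  show ?all
  proof (intro allI impI)
    fix j t assume j: "j < k" and t: "t < n"
    show "block_theta k n a j t = (if j = 0 \<and> t = 0 then - 1 else 0) - x"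
      using half t0[OF j t] j0[OF j] by (cases "t = 0"; cases "j = 0") simp_all
  qed
qed

section \<open>From the Gram matrix of the bordered matrix to conditions on shifts\<close>

text \<open>Index \<open>0\<close> is the border and \<open>Suc\<close> indices belong to
  \<open>Y\<close>. The border adds \<open>x3 * hom x3\<close> to every product of rows of
  \<open>Y\<close>. The two off-diagonal blocks of the Gram matrix are conjugate transposes of each
  other, which leaves one condition for both.\<close>

lemma bordered_gram_iff:
  assumes Y: "Y \<in> carrier_mat N N"
    and X: "X = four_block_mat (mat 1 1 (\<lambda>_. x1)) (mat_of_row (vec N (\<lambda>_. x2)))
      ((mat_of_row (vec N (\<lambda>_. x3)))\<^sup>T) Y"
  shows "mat\<^sub>h X * X\<^sup>T = - 1\<^sub>m (Suc N) \<longleftrightarrow>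
    1 + x1 * hom x1 + of_nat N * x2 * hom x2 = 0 \<and>
    (\<forall>s<N. x1 * hom x3 + x2 * (\<Sum>c<N. hom (Y $$ (s, c))) = 0) \<and>
    (\<forall>r<N. \<forall>s<N. (\<Sum>c<N. Y $$ (r, c) * hom (Y $$ (s, c))) =
      (if r = s then - 1 else 0) - x3 * hom x3)"
proof -
  have X_carrier: "X \<in> carrier_mat (Suc N) (Suc N)"
    using Y unfolding X carrier_mat_def by auto
  define g where "g r s = (\<Sum>c<Suc N. X $$ (r, c) * hom (X $$ (s, c)))" for r s
  \<comment> \<open>The conjugate sits on the first matrix factor, so position (s, r) holds the
    product of row \<open>r\<close> with the conjugate of row \<open>s\<close>.\<close>
  have entry: "(mat\<^sub>h X * X\<^sup>T) $$ (s, r) = g r s" if "r < Suc N" "s < Suc N" for r s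
    using that X_carrier unfolding g_def
    by (auto simp: scalar_prod_def atLeast0LessThan mult.commute intro!: sum.cong)
  have "mat\<^sub>h X * X\<^sup>T = - 1\<^sub>m (Suc N) \<longleftrightarrow>
      (\<forall>r<Suc N. \<forall>s<Suc N. g r s = (if r = s then - 1 else 0))"
  proof
    assume eq: "mat\<^sub>h X * X\<^sup>T = - 1\<^sub>m (Suc N)"
    show "\<forall>r<Suc N. \<forall>s<Suc N. g r s = (if r = s then - 1 else 0)"
      using entry unfolding eq by fastforce
  next
    assume eq: "\<forall>r<Suc N. \<forall>s<Suc N. g r s = (if r = s then - 1 else 0)"
    show "mat\<^sub>h X * X\<^sup>T = - 1\<^sub>m (Suc N)"
    proof (rule eq_matI)
      fix s r assume "s < dim_row (- 1\<^sub>m (Suc N) :: 'a mat)" "r < dim_col (- 1\<^sub>m (Suc N) :: 'a mat)"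
      then have "s < Suc N" "r < Suc N" by simp_all
      then show "(mat\<^sub>h X * X\<^sup>T) $$ (s, r) = (- 1\<^sub>m (Suc N)) $$ (s, r)"
        using eq entry by (simp del: index_mult_mat)
    qed (use X_carrier in auto)
  qed
  also have "\<dots> \<longleftrightarrow> g 0 0 = - 1 \<and> (\<forall>s<N. g 0 (Suc s) = 0) \<and> (\<forall>r<N. g (Suc r) 0 = 0) \<and>
      (\<forall>r<N. \<forall>s<N. g (Suc r) (Suc s) = (if r = s then - 1 else 0))"
    unfolding All_less_Suc2 by auto
  also have "\<dots> \<longleftrightarrow> g 0 0 = - 1 \<and> (\<forall>s<N. g 0 (Suc s) = 0) \<and>
      (\<forall>r<N. \<forall>s<N. g (Suc r) (Suc s) = (if r = s then - 1 else 0))"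
  proof -
    have "g (Suc r) 0 = hom (g 0 (Suc r))" for r
      unfolding g_def hom_sum hom_mult hom_hom by (simp only: mult.commute)
    then show ?thesis by auto
  qed
  also have "g 0 0 = x1 * hom x1 + of_nat N * x2 * hom x2"
    using Y unfolding g_def sum.lessThan_Suc_shift X by (simp add: mult.assoc)
  also have "x1 * hom x1 + of_nat N * x2 * hom x2 = - 1 \<longleftrightarrow>
      1 + x1 * hom x1 + of_nat N * x2 * hom x2 = 0"
    by (simp add: eq_neg_iff_add_eq_0 ac_simps)
  also have "(\<forall>s<N. g 0 (Suc s) = 0) \<longleftrightarrow> (\<forall>s<N. x1 * hom x3 + x2 * (\<Sum>c<N. hom (Y $$ (s, c))) = 0)"
  proof -
    have "g 0 (Suc s) = x1 * hom x3 + x2 * (\<Sum>c<N. hom (Y $$ (s, c)))" if "s < N" for s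
      using Y that unfolding g_def sum.lessThan_Suc_shift X by (simp add: sum_distrib_left)
    then show ?thesis by simp
  qed
  also have "(\<forall>r<N. \<forall>s<N. g (Suc r) (Suc s) = (if r = s then - 1 else 0)) \<longleftrightarrow>
      (\<forall>r<N. \<forall>s<N. (\<Sum>c<N. Y $$ (r, c) * hom (Y $$ (s, c))) =
      (if r = s then - 1 else 0) - x3 * hom x3)"
  proof -
    have "g (Suc r) (Suc s) = x3 * hom x3 + (\<Sum>c<N. Y $$ (r, c) * hom (Y $$ (s, c)))"
      if "r < N" "s < N" for r s
      using Y that unfolding g_def sum.lessThan_Suc_shift X by simp
    then show ?thesis by (simp add: eq_diff_eq add.commute)
  qed
  finally show ?thesis .
qed

text \<open>Every shift (j, t) arises as the displacement between two rows, and it is zero only when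
  the rows coincide, so pairs of rows can be traded for shifts.\<close>

lemma block_circ_gram_iff:
  assumes k: "k \<ge> 1" and n: "n \<ge> 1"
    and a: "\<And>i. i < k \<Longrightarrow> a i \<in> carrier_vec n" and A: "\<And>i. i < k \<Longrightarrow> A i = circ (a i)"
  shows "(\<forall>r<k * n. \<forall>s<k * n.
      (\<Sum>c<k * n. block_circ k n A $$ (r, c) * hom (block_circ k n A $$ (s, c))) =
      (if r = s then y else 0) - x) \<longleftrightarrow>
    (\<forall>j<k. \<forall>t<n. block_theta k n a j t = (if j = 0 \<and> t = 0 then y else 0) - x)"
    (is "?gram \<longleftrightarrow> ?theta")
proof
  assume gram: ?gram
  show ?theta
  proof (intro allI impI)
    fix j t assume j: "j < k" and t: "t < n"
    \<comment> \<open>Row \<open>0\<close> against row \<open>?s\<close> realizes the shift (j,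
      t).\<close>
    let ?s = "j * n + t"
    have "?s < Suc j * n"
      using t by simp
    also have "\<dots> \<le> k * n"
      using j by (intro mult_le_mono) auto
    finally have s: "?s < k * n" .
    have zero: "0 < k * n"
      using k n by simp
    have "?s = 0 \<longleftrightarrow> j = 0 \<and> t = 0"
      using n by auto
    moreover have "?s div n = j" "?s mod n = t"
      using t by simp_all
    moreover have "(\<Sum>c<k * n. block_circ k n A $$ (0, c) * hom (block_circ k n A $$ (?s, c))) =
        block_theta k n a ((?s div n + k - 0 div n) mod k) ((?s mod n + n - 0 mod n) mod n)"
      using zero s a A by (rule block_circ_gram)
    ultimately show "block_theta k n a j t = (if j = 0 \<and> t = 0 then y else 0) - x"
      using gram[rule_format, OF zero s] j t by (simp add: eq_commute[of 0])
  qed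
next
  assume theta: ?theta
  have diff: "(p + m - q) mod m = 0 \<longleftrightarrow> p = q" if "p < m" "q < m" for p q m :: nat
  proof (cases "q \<le> p")
    case True
    then have "p + m - q = p - q + m" by simp
    moreover have "p - q < m"
      using that by simp
    ultimately have "(p + m - q) mod m = p - q"
      by (metis mod_add_self2 mod_less)
    then show ?thesis
      using True by auto
  next
    case False
    then show ?thesis
      using that by simp
  qed
  show ?gram
  proof (intro allI impI)
    fix r s assume r: "r < k * n" and s: "s < k * n"
    have div: "r div n < k" "s div n < k" and mod: "r mod n < n" "s mod n < n"
      using r s n by (auto simp: less_mult_imp_div_less)
    have "(s div n + k - r div n) mod k = 0 \<and> (s mod n + n - r mod n) mod n = 0 \<longleftrightarrow> r = s"
      using diff[OF div(2,1)] diff[OF mod(2,1)] by (metis div_mult_mod_eq)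
    moreover have "(\<Sum>c<k * n. block_circ k n A $$ (r, c) * hom (block_circ k n A $$ (s, c))) =
        block_theta k n a ((s div n + k - r div n) mod k) ((s mod n + n - r mod n) mod n)"
      using r s a A by (rule block_circ_gram)
    ultimately show "(\<Sum>c<k * n. block_circ k n A $$ (r, c) * hom (block_circ k n A $$ (s, c))) =
        (if r = s then y else 0) - x"
      using theta k n by simp
  qed
qed

end

section \<open>Assembly of the equivalence\<close>

theorem theorem3:
  fixes \<sigma> :: "'a :: comm_ring_1 \<Rightarrow> 'a"
    and k n :: nat
    and x1 x2 x3 :: 'a
    and a :: "nat \<Rightarrow> 'a vec"
    and A :: "nat \<Rightarrow> 'a mat"
    and X2 X3 :: "'a vec"
    and X Y G :: "'a mat"
  assumes "comm_frobenius_ring (class_ring :: 'a ring)"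
    and "nontrivial_involution \<sigma>"
    and "k \<ge> 1" and "n \<ge> 1"
    and "\<And>i. i < k \<Longrightarrow> a i \<in> carrier_vec n"
    and "\<And>i. i < k \<Longrightarrow> A i = circ (a i)"
    and "X2 = vec (k * n) (\<lambda>_. x2)"
    and "X3 = vec (k * n) (\<lambda>_. x3)"
    and "Y = block_circ k n A"
    and "X = four_block_mat (mat 1 1 (\<lambda>_. x1)) (mat_of_row X2) ((mat_of_row X3)\<^sup>T) Y"
    and "G = hconcat (1\<^sub>m (k * n + 1)) X"
  shows "(\<exists>C. generator_matrix G C \<and>
              linear_code (2 * (k * n + 1)) (k * n + 1) C \<and>
              herm_self_dual \<sigma> (2 * (k * n + 1)) C)
    \<longleftrightarrow>
      1 + x1 * \<sigma> x1 + of_nat (k * n) * x2 * \<sigma> x2 = 0 \<and>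
      x1 * \<sigma> x3 + x2 * (\<Sum>i<k. \<Sum>s<n. \<sigma> (a i $ s)) = 0 \<and>
      ((\<Sum>i<k. Theta (a i) (map_vec \<sigma> (a i)) 0) = - 1 - x3 * \<sigma> x3 \<and>
       (\<forall>t \<in> {1..n div 2}.
          (\<Sum>i<k. Theta (a i) (map_vec \<sigma> (a i)) t) = - (x3 * \<sigma> x3))) \<and>
      (\<forall>j \<in> {1..k div 2}.
          (\<Sum>i<k. Theta (a ((i + j) mod k)) (map_vec \<sigma> (a i)) 0) = - (x3 * \<sigma> x3)) \<and>
      (\<forall>j \<in> {1..k - 1}. \<forall>t \<in> {1..n div 2}.
          (\<Sum>i<k. Theta (a ((i + j) mod k)) (map_vec \<sigma> (a i)) t) = - (x3 * \<sigma> x3))"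
proof -
  interpret comm_ring_hom \<sigma>
    using assms(2) by (simp add: nontrivial_involution_def)
  interpret ring_involution \<sigma>
    using assms(2) by unfold_locales (simp add: nontrivial_involution_def)
  note a = assms(5) and A = assms(6) and k = assms(3) and n = assms(4)
  define m where "m = k * n + 1"
  have Y: "Y \<in> carrier_mat (k * n) (k * n)"
    unfolding assms(9) block_circ_def by simp
  have X: "X \<in> carrier_mat m m"
    using Y unfolding assms(7,8,10) m_def carrier_mat_def by auto
  have G: "G = hconcat (1\<^sub>m m) X" and dim_G: "dim_col G = m + m"
    using hconcat_carrier[OF one_carrier_mat X] unfolding assms(11) m_def by auto
  \<comment> \<open>This invariance lets opposite shifts share one right-hand side.\<close>
  have x3: "\<sigma> (x3 * \<sigma> x3) = x3 * \<sigma> x3"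
    by (simp add: hom_mult mult.commute)
  let ?C = "code_span (m + m) (set (rows G))"
  \<comment> \<open>A generator matrix determines its code, and a systematic one always gives a free
    code of rank \<open>m\<close>, so only self-duality is left.\<close>
  have "(\<exists>C. generator_matrix G C \<and> linear_code (m + m) m C \<and> herm_self_dual \<sigma> (m + m) C) \<longleftrightarrow>
      herm_self_dual \<sigma> (m + m) ?C"
    unfolding generator_matrix_def dim_G using linear_code_systematic[OF X] G by blast
  also have "\<dots> \<longleftrightarrow> map_mat \<sigma> X * X\<^sup>T = - 1\<^sub>m m"
    unfolding G code_span_systematic[OF X] by (rule herm_self_dual_systematic[OF X])
  also have "\<dots> \<longleftrightarrow> 1 + x1 * \<sigma> x1 + of_nat (k * n) * x2 * \<sigma> x2 = 0 \<and>
      (\<forall>s<k * n. x1 * \<sigma> x3 + x2 * (\<Sum>c<k * n. \<sigma> (Y $$ (s, c))) = 0) \<and>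
      (\<forall>r<k * n. \<forall>s<k * n. (\<Sum>c<k * n. Y $$ (r, c) * \<sigma> (Y $$ (s, c))) =
        (if r = s then - 1 else 0) - x3 * \<sigma> x3)"
    using bordered_gram_iff[OF Y assms(10)[unfolded assms(7,8)]] by (simp add: m_def)
  also have "(\<forall>s<k * n. x1 * \<sigma> x3 + x2 * (\<Sum>c<k * n. \<sigma> (Y $$ (s, c))) = 0) \<longleftrightarrow>
      x1 * \<sigma> x3 + x2 * (\<Sum>i<k. \<Sum>s<n. \<sigma> (a i $ s)) = 0"
  proof -
    \<comment> \<open>There is at least one row, so the quantified condition is not vacuous and
      collapses to its common instance.\<close>
    have "0 < k * n"
      using k n by simp
    then show ?thesis
      unfolding assms(9) using block_circ_row_sum[OF _ a A] by fastforce
  qed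
  also have "(\<forall>r<k * n. \<forall>s<k * n. (\<Sum>c<k * n. Y $$ (r, c) * \<sigma> (Y $$ (s, c))) =
        (if r = s then - 1 else 0) - x3 * \<sigma> x3) \<longleftrightarrow>
      (block_theta k n a 0 0 = - 1 - x3 * \<sigma> x3 \<and>
        (\<forall>t\<in>{1..n div 2}. block_theta k n a 0 t = - (x3 * \<sigma> x3))) \<and>
      (\<forall>j\<in>{1..k div 2}. block_theta k n a j 0 = - (x3 * \<sigma> x3)) \<and>
      (\<forall>j\<in>{1..k - 1}. \<forall>t\<in>{1..n div 2}. block_theta k n a j t = - (x3 * \<sigma> x3))"
    unfolding assms(9)
    by (rule trans[OF block_circ_gram_iff[OF k n a A] block_theta_values_iff[OF k n x3]])
  finally have main: "(\<exists>C. generator_matrix G C \<and> linear_code (m + m) m C \<and> herm_self_dual \<sigma> (m + m) C) \<longleftrightarrow>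
      1 + x1 * \<sigma> x1 + of_nat (k * n) * x2 * \<sigma> x2 = 0 \<and>
      x1 * \<sigma> x3 + x2 * (\<Sum>i<k. \<Sum>s<n. \<sigma> (a i $ s)) = 0 \<and>
      (block_theta k n a 0 0 = - 1 - x3 * \<sigma> x3 \<and>
        (\<forall>t\<in>{1..n div 2}. block_theta k n a 0 t = - (x3 * \<sigma> x3))) \<and>
      (\<forall>j\<in>{1..k div 2}. block_theta k n a j 0 = - (x3 * \<sigma> x3)) \<and>
      (\<forall>j\<in>{1..k - 1}. \<forall>t\<in>{1..n div 2}. block_theta k n a j t = - (x3 * \<sigma> x3))" .
  have Theta: "(\<Sum>i<k. Theta (a ((i + j) mod k)) (map_vec \<sigma> (a i)) t) = block_theta k n a j t" for j t
    using a by (rule sum_Theta_eq_block_theta)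
  have "(\<Sum>i<k. Theta (a i) (map_vec \<sigma> (a i)) t) =
      (\<Sum>i<k. Theta (a ((i + 0) mod k)) (map_vec \<sigma> (a i)) t)" for t
    by (intro sum.cong) auto
  then have Theta_0: "(\<Sum>i<k. Theta (a i) (map_vec \<sigma> (a i)) t) = block_theta k n a 0 t" for t
    unfolding Theta .
  show ?thesis
    using main unfolding Theta_0 Theta m_def mult_2 .
qed

end
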